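(* Fix $\delta\in(0,1)$, any feasible confidence allocation $\boldsymbol{\delta}=(\delta_v)_{v\in\mathcal T\setminus\{r\}}$ (that is, $\delta_v\in(0,1)$ and $\sum_{v\in\mathcal T\setminus\{r\}}\delta_v\le\delta$) and any $\varepsilon\ge 0$. Run the algorithm 2FFS (described in the context) with accuracy $\varepsilon$, let $\tau$ be its stopping time, and, on $\{\tau<\infty\}$, let $\hat a_\tau\in\mathrm{Ch}(r)$ be the returned root child. Then $$\mathbb P\bigl(\tau<\infty\ \text{ and }\ V^*(r,a^* )-V^*(r,\hat a_\tau)>\varepsilon\bigr)\le\delta .$$ In fact, on the simultaneous-validity event $\mathcal E_\delta$, every finite-time recommendation made by the stopping rule is $\varepsilon$-optimal, i.e. if $\tau<\infty$ then $V^*(r,a^* )-V^*(r,\hat a_\tau)\le\varepsilon$. Consequently, whenever the algorithm stops, its recommendation is $(\varepsilon,\delta)$-PAC.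
   Context: **Tree.** $\mathcal T$ is a finite rooted tree with root $r$ and depth $D\ge1$; internal nodes alternate between Max and Min nodes by level, and $r$ is a Max node. $\mathrm{Ch}(v)$ is the set of children of $v$, $d(v)$ its depth, $h(v)=D-d(v)$ its remaining depth; $v$ is a leaf iff $h(v)=0$. Each leaf $\ell$ has a mean payoff $\mu_\ell\in\mathbb R$. The minimax value is $V^*(\ell)=\mu_\ell$ at leaves, $V^*(v)=\max_{u\in\mathrm{Ch}(v)}V^*(u)$ at Max nodes, $V^*(v)=\min_{u\in\mathrm{Ch}(v)}V^*(u)$ at Min nodes. For $a\in\mathrm{Ch}(r)$ write $V^*(r,a)=V^*(a)$. Assume $|\mathrm{Ch}(r)|\ge2$ and that the optimal root action $a^*=\arg\max_{a\in\mathrm{Ch}(r)}V^*(r,a)$ is unique. **Oracles.** A known function $B:\{0,\dots,D\}\to[0,\infty)$ satisfies $B(0)=0$ and $B(h+1)\ge B(h)$. The fast oracle (cost $1$ per query) returns a deterministic value $V_F(v)$ with $|V_F(v)-V^*(v)|\le B(h(v))$. The slow oracle (cost $c\ge1$ per query) returns, on repeated queries at $v$, independent $\sigma$-sub-Gaussian samples with mean $V^*(v)$. $\widehat V_{v,n}$ is the empirical mean of the first $n$ slow samples at $v$. The confidence radius $\beta_v(\cdot,\delta_v)$ is non-increasing in $n$, tends to $0$ as $n\to\infty$, and satisfies $\mathbb P(\exists n\ge1: |\widehat V_{v,n}-V^*(v)|>\beta_v(n,\delta_v))\le\delta_v$. The simultaneous-validity event is $$\mathcal E_\delta=\bigcap_{v\in\mathcal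 T\setminus\{r\}}\bigcap_{n\ge1}\{|\widehat V_{v,n}-V^*(v)|\le\beta_v(n,\delta_v)\}.$$ **Intervals.** A node is exposed once it enters the explored subtree (which always contains $r$ and, after initialization, $\mathrm{Ch}(r)$). Expanding an exposed internal node exposes all its children and queries the fast oracle once at each. For an exposed $v\ne r$, with $N_v^S(t)$ slow samples so far: $I_v^F=[V_F(v)-B(h(v)),V_F(v)+B(h(v))]$; $I_v^S(t)=\bigcap_{j=1}^{N_v^S(t)}[\widehat V_{v,j}-\beta_v(j,\delta_v),\widehat V_{v,j}+\beta_v(j,\delta_v)]$ (equal to $\mathbb R$ if $N_v^S(t)=0$); $I_v^{\mathrm{loc}}(t)=I_v^F\cap I_v^S(t)$. If $v$ is an expanded internal node, $I_v^{\mathrm{ch}}(t)=[\max_{u}L_u(t),\max_{u}U_u(t)]$ for Max nodes and $[\min_{u}L_u(t),\min_{u}U_u(t)]$ for Min nodes ($u$ ranging over $\mathrm{Ch}(v)$); otherwise $I_v^{\mathrm{ch}}(t)=\mathbb R$. The effective interval is $I_v(t)=[L_v(t),U_v(t)]=I_v^{\mathrm{loc}}(t)\cap I_v^{\mathrm{ch}}(t)$ for $v\neq r$, and $I_r(t)=I_r^{\mathrm{ch}}(t)$. On $\mathcal E_\delta$ all these intervals are nonempty; the behaviour of the algorithm off $\mathcal E_\delta$ when intersections are empty is immaterial. **Scales and local costs.** For $\rho>0$ let $m_v(\rho,\delta_v)=\inf\{n\ge1:\beta_v(n,\delta_v)\le\rho/4\}$ and $\Gamma_v(\rho,\delta_v)=0$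 if $B(h(v))\le\rho/4$, $\Gamma_v(\rho,\delta_v)=c\,m_v(\rho,\delta_v)$ otherwise. After initialization (fast queries at all root children), $\rho_0=\max_{a\in\mathrm{Ch}(r)}(U_a(0)-L_a(0))$ and $\rho_{k+1}=\rho_k/2$; if $\rho_0=0$ the algorithm stops immediately. Write $\Gamma_v^{(k)}(\delta_v)=\Gamma_v(\rho_k,\delta_v)$. A nondecreasing sequence of depth budgets $\alpha_h\ge1$, $h=0,\dots,D$, is an input. **Certificates.** Sides are $s\in\{L,U\}$, with $\bar L=U$, $\bar U=L$. Call $(v,s)$ a comparison case if ($v$ Max, $s=L$) or ($v$ Min, $s=U$), and a selector case otherwise. The algorithm keeps flags $\mathsf{Done}_s(v,k)\in\{0,1\}$, initially $0$. At the current state $t$, predicates are defined upward from the leaves of the explored tree: $\mathsf{Comp}_s(v,k,t)$ holds iff $\mathsf{Done}_s(v,k)=1$ or $\mathsf{Cert}_s(v,k,t)$; $\mathsf{Cert}_s(v,k,t)$ holds iff $U_v(t)-L_v(t)\le\rho_k/2$, or $I_v^{\mathrm{loc}}(t)$ has width $\le\rho_k/2$, or $v$ is an expanded internal node and - ($v$ Max, $s=L$): every $u\in\mathrm{Ch}(v)$ satisfies $U_u(t)\le\lambda_L(v,t)+\rho_k/2$ or $\mathsf{Comp}_L(u,k,t)$, where $\lambda_L(v,t)=\max_{u\in\mathrm{Ch}(v)}L_u(t)$; - ($v$ Min, $s=U$): every $u\in\mathrm{Ch}(v)$ satisfies $L_u(t)\ge\lambda_U(v,t)-\rho_k/2$ or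 $\mathsf{Comp}_U(u,k,t)$, where $\lambda_U(v,t)=\min_{u\in\mathrm{Ch}(v)}U_u(t)$; - (selector case): $\mathsf{Comp}_s(u,k,t)$ for every $u\in A_s(v,k,t)$. Active child sets: $A_L(v,k,t)=\arg\min_{u}L_u(t)$ for $v$ Min; $A_U(v,k,t)=\arg\max_uU_u(t)$ for $v$ Max; $A_L(v,k,t)=\{u:U_u(t)>\lambda_L(v,t)+\rho_k/2,\ \neg\mathsf{Comp}_L(u,k,t)\}$ for $v$ Max; $A_U(v,k,t)=\{u:L_u(t)<\lambda_U(v,t)-\rho_k/2,\ \neg\mathsf{Comp}_U(u,k,t)\}$ for $v$ Min. In comparison cases the blocker is $b_L(v,k,t)\in\arg\max_{u\in A_L(v,k,t)}U_u(t)$, resp. $b_U(v,k,t)\in\arg\min_{u\in A_U(v,k,t)}L_u(t)$. For $x$ with width $w=U_x(t)-L_x(t)>0$ let $\underline k(x,t)$ be the integer $k\ge0$ with $\rho_k/2<w\le\rho_k$, and $K_s(x,t)=\min\{k\ge\underline k(x,t):\neg\mathsf{Comp}_s(x,k,t)\}$ ($+\infty$ if $w=0$ or the set is empty). Also $K_s^{\le k}(x,t)=\min\{0\le j\le k:\neg\mathsf{Comp}_s(x,j,t)\}$ ($+\infty$ if empty). **Algorithm 2FFS.** Counters $M^{\mathrm{loc}}_{v,k},M^{\mathrm{exp}}_{v,k}$ start at $0$. $\mathrm{Refresh}(k)$: recompute all affected intervals up to the root, and set $\mathsf{Done}_{s'}(y,k)=1$ for every affected node $y$ (the updated node and its explored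 ancestors) and side $s'$ with $\mathsf{Cert}_{s'}(y,k,t)$. $\mathrm{LocalStep}(v,k,B)$: if $B<c$ return $(0,\mathsf{blocked})$; else take one slow sample at $v$, add $c$ to $M^{\mathrm{loc}}_{v,k}$, $\mathrm{Refresh}(k)$, return $(c,\mathsf{progress})$. $\mathrm{Resolve}(v,s,k,B)$: (1) If $\mathsf{Comp}_s(v,k,t)$, set $\mathsf{Done}_s(v,k)=1$ and return $(0,\mathsf{cert})$. (2) If $h(v)=0$, return $\mathrm{LocalStep}(v,k,B)$. (3) Let $R=\alpha_{h(v)}\Gamma_v^{(k)}(\delta_v)-M^{\mathrm{exp}}_{v,k}$; if $R\le0$ return $\mathrm{LocalStep}(v,k,B)$. (4) If $v$ is unexpanded: if $|\mathrm{Ch}(v)|>R$ return $\mathrm{LocalStep}(v,k,B)$; else if $|\mathrm{Ch}(v)|>B$ return $(0,\mathsf{blocked})$; else expand $v$, add $|\mathrm{Ch}(v)|$ to $M^{\mathrm{exp}}_{v,k}$, $\mathrm{Refresh}(k)$, return $(|\mathrm{Ch}(v)|,\mathsf{progress})$. (5) If $v$ is expanded, choose $(u,s_u,k_u)$: in a comparison case let $u=b_s(v,k,t)$ and take $(s_u,k_u)=(\bar s,K_{\bar s}^{\le k}(u,t))$ if this scale is finite, otherwise $(s,K_s^{\le k}(u,t))$; in a selector case choose $u\in A_s(v,k,t)$ with $\neg\mathsf{Comp}_s(u,k,t)$ of maximal width $U_u(t)-L_u(t)$ and $(s_u,k_u)=(s,K_s^{\le k}(u,t))$. Let $(q,z)=\mathrm{Resolve}(u,s_u,k_u,\min\{B,R\})$.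 If $z=\mathsf{blocked}$: return $(0,\mathsf{blocked})$ if $B<R$, else return $\mathrm{LocalStep}(v,k,B)$. Otherwise add $q$ to $M^{\mathrm{exp}}_{v,k}$, $\mathrm{Refresh}(k)$, return $(q,z)$. Driver: query the fast oracle at every root child. While no $\hat a\in\mathrm{Ch}(r)$ satisfies $L_{\hat a}(t)\ge\max_{a\ne\hat a}U_a(t)-\varepsilon$: let $a\in\arg\max_{y\in\mathrm{Ch}(r)}L_y(t)$, $b\in\arg\max_{y\in\mathrm{Ch}(r)\setminus\{a\}}U_y(t)$, $k_a=K_L(a,t)$; let $(s_b,k_b)=(L,K_L(b,t))$ if $K_L(b,t)<\infty$ and ($K_U(b,t)=\infty$ or $\rho_{K_L(b,t)}\ge\rho_{K_U(b,t)}$), and $(s_b,k_b)=(U,K_U(b,t))$ otherwise. If $k_a<\infty$ and ($k_b=\infty$ or $\rho_{k_a}\ge\rho_{k_b}$) call $\mathrm{Resolve}(a,L,k_a,+\infty)$, else call $\mathrm{Resolve}(b,s_b,k_b,+\infty)$. When the loop ends (time $\tau$), return any $\hat a_\tau\in\mathrm{Ch}(r)$ with $L_{\hat a_\tau}(\tau)\ge\max_{a\ne\hat a_\tau}U_a(\tau)-\varepsilon$. Remaining ties are broken arbitrarily. **PAC.** A recommendation is $(\varepsilon,\delta)$-PAC if the probability that it satisfies $V^*(r,a^* )-V^*(r,\hat a_\tau)>\varepsilon$ is at most $\delta$. *)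

theory Defs
  imports "HOL-Probability.Probability"
begin

section \<open>The game tree\<close>

record 'v game_tree =
  tnodes :: "'v set"
  troot :: 'v
  tchildren :: "'v \<Rightarrow> 'v set"
  payoff :: "'v \<Rightarrow> real"

definition tedges :: "('v, 'z) game_tree_scheme \<Rightarrow> ('v \<times> 'v) set" where
  "tedges G = {(v, u). v \<in> tnodes G \<and> u \<in> tchildren G v}"

definition rooted_tree :: "('v, 'z) game_tree_scheme \<Rightarrow> bool" where
  "rooted_tree G \<longleftrightarrow>
     finite (tnodes G) \<and> troot G \<in> tnodes G \<and>
     (\<forall>v\<in>tnodes G. tchildren G v \<subseteq> tnodes G) \<and>
     (\<forall>v\<in>tnodes G. troot G \<notin> tchildren G v) \<and>
     (\<forall>u\<in>tnodes G - {troot G}. \<exists>!v. v \<in> tnodes G \<and> u \<in> tchildren G v) \<and>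
     (\<forall>u\<in>tnodes G. (troot G, u) \<in> (tedges G)\<^sup>*)"

definition node_depth :: "('v, 'z) game_tree_scheme \<Rightarrow> 'v \<Rightarrow> nat" where
  "node_depth G v = (LEAST n. (troot G, v) \<in> tedges G ^^ n)"

definition tree_depth :: "('v, 'z) game_tree_scheme \<Rightarrow> nat" where
  "tree_depth G = Max (node_depth G ` tnodes G)"

definition rem_depth :: "('v, 'z) game_tree_scheme \<Rightarrow> 'v \<Rightarrow> nat" where
  "rem_depth G v = tree_depth G - node_depth G v"

definition is_max :: "('v, 'z) game_tree_scheme \<Rightarrow> 'v \<Rightarrow> bool" where
  "is_max G v \<longleftrightarrow> even (node_depth G v)"

text \<open>
  Here and below, the recursion over the tree is a recursion on the remaining depth: a function with
  suffix \<open>_at\<close> is meant to be applied to \<open>rem_depth G v\<close> and \<open>v\<close>.  It relies on the assumption that the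
  leaves are exactly the nodes of remaining depth 0.
\<close>

primrec minimax_at :: "('v, 'z) game_tree_scheme \<Rightarrow> nat \<Rightarrow> 'v \<Rightarrow> real" where
  "minimax_at G 0 v = payoff G v"
| "minimax_at G (Suc h) v =
     (if is_max G v then Max (minimax_at G h ` tchildren G v)
      else Min (minimax_at G h ` tchildren G v))"

definition minimax :: "('v, 'z) game_tree_scheme \<Rightarrow> 'v \<Rightarrow> real" where
  "minimax G v = minimax_at G (rem_depth G v) v"

definition argmax_set :: "('a \<Rightarrow> real) \<Rightarrow> 'a set \<Rightarrow> 'a set" where
  "argmax_set f S = {x \<in> S. \<forall>y\<in>S. f y \<le> f x}"

definition argmin_set :: "('a \<Rightarrow> real) \<Rightarrow> 'a set \<Rightarrow> 'a set" where
  "argmin_set f S = {x \<in> S. \<forall>y\<in>S. f x \<le> f y}"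


section \<open>Oracles and inputs of the algorithm\<close>

text \<open>
  \<open>conf_radius G v n d\<close> is the radius $\beta_v(n,d)$, \<open>alloc G v\<close> is $\delta_v$, \<open>budget G h\<close> is
  $\alpha_h$, and \<open>fast_value\<close> is the (deterministic) answer of the fast oracle.
\<close>

record 'v ffs_input = "'v game_tree" +
  bias :: "nat \<Rightarrow> real"
  fast_value :: "'v \<Rightarrow> real"
  slow_cost :: real
  conf_radius :: "'v \<Rightarrow> nat \<Rightarrow> real \<Rightarrow> real"
  alloc :: "'v \<Rightarrow> real"
  budget :: "nat \<Rightarrow> real"

text \<open>A realisation of the slow oracle: \<open>x v i\<close> is the sample number \<open>i + 1\<close> at node \<open>v\<close>.\<close>

type_synonym 'v samples = "'v \<Rightarrow> nat \<Rightarrow> real"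

definition emp_mean :: "'v samples \<Rightarrow> 'v \<Rightarrow> nat \<Rightarrow> real" where
  "emp_mean x v n = (\<Sum>i<n. x v i) / real n"

definition sub_gaussian :: "'w measure \<Rightarrow> real \<Rightarrow> real \<Rightarrow> ('w \<Rightarrow> real) \<Rightarrow> bool" where
  "sub_gaussian M \<sigma> m Y \<longleftrightarrow>
     integrable M Y \<and> integral\<^sup>L M Y = m \<and>
     (\<forall>l::real. integrable M (\<lambda>\<omega>. exp (l * (Y \<omega> - m))) \<and>
        integral\<^sup>L M (\<lambda>\<omega>. exp (l * (Y \<omega> - m))) \<le> exp (l\<^sup>2 * \<sigma>\<^sup>2 / 2))"

definition simultaneous_validity ::
    "'w measure \<Rightarrow> 'v ffs_input \<Rightarrow> ('v \<Rightarrow> nat \<Rightarrow> 'w \<Rightarrow> real) \<Rightarrow> 'w set" where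
  "simultaneous_validity M G X =
     {\<omega> \<in> space M. \<forall>v\<in>tnodes G - {troot G}. \<forall>n\<ge>1.
        \<bar>emp_mean (\<lambda>v i. X v i \<omega>) v n - minimax G v\<bar> \<le> conf_radius G v n (alloc G v)}"


section \<open>Search states and intervals\<close>

datatype side = Lo | Up

fun other_side :: "side \<Rightarrow> side" where
  "other_side Lo = Up"
| "other_side Up = Lo"

text \<open>
  A state describes what has been done so far; the intervals are functions of the state and of the
  realised samples.  The exposed nodes are the root and the children of expanded nodes.
\<close>

record 'v ffs_state =
  expanded :: "'v set"
  nslow :: "'v \<Rightarrow> nat"
  flag :: "side \<Rightarrow> 'v \<Rightarrow> nat \<Rightarrow> bool"
  mloc :: "'v \<Rightarrow> nat \<Rightarrow> real"
  mexp :: "'v \<Rightarrow> nat \<Rightarrow> real"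

text \<open>The state after initialization, when the root children are exposed.\<close>

definition init_state :: "'v ffs_input \<Rightarrow> 'v ffs_state" where
  "init_state G =
     \<lparr>expanded = {troot G}, nslow = (\<lambda>_. 0), flag = (\<lambda>_ _ _. False),
      mloc = (\<lambda>_ _. 0), mexp = (\<lambda>_ _. 0)\<rparr>"

definition fast_ivl :: "'v ffs_input \<Rightarrow> 'v \<Rightarrow> real set" where
  "fast_ivl G v = {fast_value G v - bias G (rem_depth G v) .. fast_value G v + bias G (rem_depth G v)}"

definition slow_ivl :: "'v ffs_input \<Rightarrow> 'v samples \<Rightarrow> 'v ffs_state \<Rightarrow> 'v \<Rightarrow> real set" where
  "slow_ivl G x st v =
     (\<Inter>j\<in>{1..nslow st v}.
        {emp_mean x v j - conf_radius G v j (alloc G v) ..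
         emp_mean x v j + conf_radius G v j (alloc G v)})"

definition loc_ivl :: "'v ffs_input \<Rightarrow> 'v samples \<Rightarrow> 'v ffs_state \<Rightarrow> 'v \<Rightarrow> real set" where
  "loc_ivl G x st v = fast_ivl G v \<inter> slow_ivl G x st v"

text \<open>
  The endpoints of an interval are its infimum and supremum.  For an empty interval (which does not
  occur on the simultaneous-validity event) they are unspecified reals.
\<close>

definition ch_ivl ::
    "'v ffs_input \<Rightarrow> 'v ffs_state \<Rightarrow> ('v \<Rightarrow> real set) \<Rightarrow> 'v \<Rightarrow> real set" where
  "ch_ivl G st I v =
     (if v \<in> expanded st then
        (if is_max G v
         then {Max ((\<lambda>u. Inf (I u)) ` tchildren G v) .. Max ((\<lambda>u. Sup (I u)) ` tchildren G v)}
         else {Min ((\<lambda>u. Inf (I u)) ` tchildren G v) .. Min ((\<lambda>u. Sup (I u)) ` tchildren G v)})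
      else UNIV)"

primrec ivl_at ::
    "'v ffs_input \<Rightarrow> 'v samples \<Rightarrow> 'v ffs_state \<Rightarrow> nat \<Rightarrow> 'v \<Rightarrow> real set" where
  "ivl_at G x st 0 v = loc_ivl G x st v"
| "ivl_at G x st (Suc h) v =
     (if v = troot G then ch_ivl G st (ivl_at G x st h) v
      else loc_ivl G x st v \<inter> ch_ivl G st (ivl_at G x st h) v)"

definition ivl :: "'v ffs_input \<Rightarrow> 'v samples \<Rightarrow> 'v ffs_state \<Rightarrow> 'v \<Rightarrow> real set" where
  "ivl G x st v = ivl_at G x st (rem_depth G v) v"

definition lower :: "'v ffs_input \<Rightarrow> 'v samples \<Rightarrow> 'v ffs_state \<Rightarrow> 'v \<Rightarrow> real" where
  "lower G x st v = Inf (ivl G x st v)"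

definition upper :: "'v ffs_input \<Rightarrow> 'v samples \<Rightarrow> 'v ffs_state \<Rightarrow> 'v \<Rightarrow> real" where
  "upper G x st v = Sup (ivl G x st v)"

definition width :: "'v ffs_input \<Rightarrow> 'v samples \<Rightarrow> 'v ffs_state \<Rightarrow> 'v \<Rightarrow> real" where
  "width G x st v = upper G x st v - lower G x st v"

definition loc_width :: "'v ffs_input \<Rightarrow> 'v samples \<Rightarrow> 'v ffs_state \<Rightarrow> 'v \<Rightarrow> real" where
  "loc_width G x st v = Sup (loc_ivl G x st v) - Inf (loc_ivl G x st v)"


section \<open>Scales and local costs\<close>

definition scale :: "'v ffs_input \<Rightarrow> 'v samples \<Rightarrow> nat \<Rightarrow> real" where
  "scale G x k = Max (width G x (init_state G) ` tchildren G (troot G)) / 2 ^ k"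

definition sample_count :: "'v ffs_input \<Rightarrow> 'v \<Rightarrow> real \<Rightarrow> nat" where
  "sample_count G v \<rho> = Inf {n. 1 \<le> n \<and> conf_radius G v n (alloc G v) \<le> \<rho> / 4}"

definition local_cost :: "'v ffs_input \<Rightarrow> 'v \<Rightarrow> real \<Rightarrow> real" where
  "local_cost G v \<rho> =
     (if bias G (rem_depth G v) \<le> \<rho> / 4 then 0 else slow_cost G * real (sample_count G v \<rho>))"


section \<open>Certificates\<close>

definition comparison_case :: "'v ffs_input \<Rightarrow> 'v \<Rightarrow> side \<Rightarrow> bool" where
  "comparison_case G v s \<longleftrightarrow> (is_max G v \<and> s = Lo) \<or> (\<not> is_max G v \<and> s = Up)"

definition lam_Lo :: "'v ffs_input \<Rightarrow> 'v samples \<Rightarrow> 'v ffs_state \<Rightarrow> 'v \<Rightarrow> real" where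
  "lam_Lo G x st v = Max (lower G x st ` tchildren G v)"

definition lam_Up :: "'v ffs_input \<Rightarrow> 'v samples \<Rightarrow> 'v ffs_state \<Rightarrow> 'v \<Rightarrow> real" where
  "lam_Up G x st v = Min (upper G x st ` tchildren G v)"

text \<open>The active children in the selector cases (\<open>v\<close> Min, \<open>Lo\<close>) and (\<open>v\<close> Max, \<open>Up\<close>).\<close>

definition selector_children ::
    "'v ffs_input \<Rightarrow> 'v samples \<Rightarrow> 'v ffs_state \<Rightarrow> 'v \<Rightarrow> side \<Rightarrow> 'v set" where
  "selector_children G x st v s =
     (case s of
        Lo \<Rightarrow> argmin_set (lower G x st) (tchildren G v)
      | Up \<Rightarrow> argmax_set (upper G x st) (tchildren G v))"

text \<open>
  The upward definition of the two predicates is the least fixed point of their clauses.  The clause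
  for \<open>loc_width\<close> excludes the root, which has no local interval.
\<close>

inductive
  comp :: "'v ffs_input \<Rightarrow> 'v samples \<Rightarrow> 'v ffs_state \<Rightarrow> nat \<Rightarrow> side \<Rightarrow> 'v \<Rightarrow> bool" and
  cert :: "'v ffs_input \<Rightarrow> 'v samples \<Rightarrow> 'v ffs_state \<Rightarrow> nat \<Rightarrow> side \<Rightarrow> 'v \<Rightarrow> bool"
  for G :: "'v ffs_input" and x :: "'v samples" and st :: "'v ffs_state" and k :: nat
where
  comp_flag: "flag st s v k \<Longrightarrow> comp G x st k s v"
| comp_cert: "cert G x st k s v \<Longrightarrow> comp G x st k s v"
| cert_width: "width G x st v \<le> scale G x k / 2 \<Longrightarrow> cert G x st k s v"
| cert_loc: "v \<noteq> troot G \<Longrightarrow> loc_width G x st v \<le> scale G x k / 2 \<Longrightarrow> cert G x st k s v"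
| cert_max_Lo:
    "v \<in> expanded st \<Longrightarrow> is_max G v \<Longrightarrow>
     \<forall>u\<in>tchildren G v. upper G x st u \<le> lam_Lo G x st v + scale G x k / 2 \<or> comp G x st k Lo u \<Longrightarrow>
     cert G x st k Lo v"
| cert_min_Up:
    "v \<in> expanded st \<Longrightarrow> \<not> is_max G v \<Longrightarrow>
     \<forall>u\<in>tchildren G v. lower G x st u \<ge> lam_Up G x st v - scale G x k / 2 \<or> comp G x st k Up u \<Longrightarrow>
     cert G x st k Up v"
| cert_selector:
    "v \<in> expanded st \<Longrightarrow> \<not> comparison_case G v s \<Longrightarrow>
     \<forall>u\<in>selector_children G x st v s. comp G x st k s u \<Longrightarrow>
     cert G x st k s v"

definition active_children ::
    "'v ffs_input \<Rightarrow> 'v samples \<Rightarrow> 'v ffs_state \<Rightarrow> side \<Rightarrow> 'v \<Rightarrow> nat \<Rightarrow> 'v set" where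
  "active_children G x st s v k =
     (if \<not> comparison_case G v s then selector_children G x st v s
      else case s of
        Lo \<Rightarrow> {u \<in> tchildren G v.
                upper G x st u > lam_Lo G x st v + scale G x k / 2 \<and> \<not> comp G x st k Lo u}
      | Up \<Rightarrow> {u \<in> tchildren G v.
                lower G x st u < lam_Up G x st v - scale G x k / 2 \<and> \<not> comp G x st k Up u})"

definition blockers ::
    "'v ffs_input \<Rightarrow> 'v samples \<Rightarrow> 'v ffs_state \<Rightarrow> side \<Rightarrow> 'v \<Rightarrow> nat \<Rightarrow> 'v set" where
  "blockers G x st s v k =
     (case s of
        Lo \<Rightarrow> argmax_set (upper G x st) (active_children G x st s v k)
      | Up \<Rightarrow> argmin_set (lower G x st) (active_children G x st s v k))"

definition natural_scale :: "'v ffs_input \<Rightarrow> 'v samples \<Rightarrow> 'v ffs_state \<Rightarrow> 'v \<Rightarrow> nat" where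
  "natural_scale G x st y =
     (THE k. scale G x k / 2 < width G x st y \<and> width G x st y \<le> scale G x k)"

text \<open>In \<^typ>\<open>enat\<close> the infimum of the empty set is \<open>\<infinity>\<close>.\<close>

definition next_scale ::
    "'v ffs_input \<Rightarrow> 'v samples \<Rightarrow> 'v ffs_state \<Rightarrow> side \<Rightarrow> 'v \<Rightarrow> enat" where
  "next_scale G x st s y =
     (if width G x st y > 0
      then Inf (enat ` {k. natural_scale G x st y \<le> k \<and> \<not> comp G x st k s y})
      else \<infinity>)"

definition next_scale_le ::
    "'v ffs_input \<Rightarrow> 'v samples \<Rightarrow> 'v ffs_state \<Rightarrow> nat \<Rightarrow> side \<Rightarrow> 'v \<Rightarrow> enat" where
  "next_scale_le G x st k s y = Inf (enat ` {j. j \<le> k \<and> \<not> comp G x st j s y})"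


section \<open>The algorithm\<close>

text \<open>
  \<open>Progress y\<close> records the node \<open>y\<close> that was sampled or expanded, since this is the updated node of
  the subsequent refreshes along the path of recursive calls.
\<close>

datatype 'v status = Certified | Blocked | Progress 'v

definition refresh ::
    "'v ffs_input \<Rightarrow> 'v samples \<Rightarrow> nat \<Rightarrow> 'v \<Rightarrow> 'v ffs_state \<Rightarrow> 'v ffs_state" where
  "refresh G x k y st =
     st\<lparr>flag := (\<lambda>s v j. flag st s v j \<or>
          (j = k \<and> v \<in> tnodes G \<and> (v, y) \<in> (tedges G)\<^sup>* \<and> cert G x st k s v))\<rparr>"

definition local_step ::
    "'v ffs_input \<Rightarrow> 'v samples \<Rightarrow> 'v \<Rightarrow> nat \<Rightarrow> ereal \<Rightarrow> 'v ffs_state \<Rightarrow>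
     (real \<times> 'v status) \<times> 'v ffs_state" where
  "local_step G x v k b st =
     (if b < ereal (slow_cost G) then ((0, Blocked), st)
      else ((slow_cost G, Progress v),
            refresh G x k v
              (st\<lparr>nslow := (nslow st)(v := nslow st v + 1),
                  mloc := (mloc st)(v := (mloc st v)(k := mloc st v k + slow_cost G))\<rparr>)))"

definition add_mexp :: "'v \<Rightarrow> nat \<Rightarrow> real \<Rightarrow> 'v ffs_state \<Rightarrow> 'v ffs_state" where
  "add_mexp v k q st = st\<lparr>mexp := (mexp st)(v := (mexp st v)(k := mexp st v k + q))\<rparr>"

definition set_flag :: "side \<Rightarrow> 'v \<Rightarrow> nat \<Rightarrow> 'v ffs_state \<Rightarrow> 'v ffs_state" where
  "set_flag s v k st = st\<lparr>flag := (flag st)(s := (flag st s)(v := (flag st s v)(k := True)))\<rparr>"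

text \<open>
  The child, side and scale of the recursive call at an expanded node.  The parameter \<open>tie\<close> picks an
  element from every nonempty set of candidates.
\<close>

definition choose_call ::
    "'v ffs_input \<Rightarrow> 'v samples \<Rightarrow> ('v set \<Rightarrow> 'v) \<Rightarrow> 'v ffs_state \<Rightarrow> 'v \<Rightarrow> side \<Rightarrow> nat \<Rightarrow>
     'v \<times> side \<times> nat" where
  "choose_call G x tie st v s k =
     (if comparison_case G v s then
        (let u = tie (blockers G x st s v k) in
          if next_scale_le G x st k (other_side s) u < \<infinity>
          then (u, other_side s, the_enat (next_scale_le G x st k (other_side s) u))
          else (u, s, the_enat (next_scale_le G x st k s u)))
      else
        (let u = tie (argmax_set (width G x st)
                   {u \<in> active_children G x st s v k. \<not> comp G x st k s u}) in
          (u, s, the_enat (next_scale_le G x st k s u))))"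

text \<open>
  \<open>resolve_at\<close> returns the pair of charged cost and status, and the new state.  The recursive call
  never reports \<open>Certified\<close>, because the chosen child is not complete at the chosen scale; the value
  in this case, where no interval is affected, is given for totality.
\<close>

primrec resolve_at ::
    "'v ffs_input \<Rightarrow> 'v samples \<Rightarrow> ('v set \<Rightarrow> 'v) \<Rightarrow> nat \<Rightarrow>
     'v \<Rightarrow> side \<Rightarrow> nat \<Rightarrow> ereal \<Rightarrow> 'v ffs_state \<Rightarrow> (real \<times> 'v status) \<times> 'v ffs_state" where
  "resolve_at G x tie 0 v s k b st =
     (if comp G x st k s v then ((0, Certified), set_flag s v k st)
      else local_step G x v k b st)"
| "resolve_at G x tie (Suc h) v s k b st =
     (if comp G x st k s v then ((0, Certified), set_flag s v k st)
      else
       (let R = budget G (Suc h) * local_cost G v (scale G x k) - mexp st v k;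
            e = real (card (tchildren G v))
        in
        if R \<le> 0 then local_step G x v k b st
        else if v \<notin> expanded st then
          (if e > R then local_step G x v k b st
           else if ereal e > b then ((0, Blocked), st)
           else ((e, Progress v),
                 refresh G x k v (add_mexp v k e (st\<lparr>expanded := insert v (expanded st)\<rparr>))))
        else
          (case choose_call G x tie st v s k of (u, s', k') \<Rightarrow>
            (case resolve_at G x tie h u s' k' (min b (ereal R)) st of ((q, z), st') \<Rightarrow>
              (case z of
                 Blocked \<Rightarrow>
                   (if b < ereal R then ((0, Blocked), st') else local_step G x v k b st')
               | Progress y \<Rightarrow> ((q, z), refresh G x k y (add_mexp v k q st'))
               | Certified \<Rightarrow> ((q, z), add_mexp v k q st'))))))"

definition resolve ::
    "'v ffs_input \<Rightarrow> 'v samples \<Rightarrow> ('v set \<Rightarrow> 'v) \<Rightarrow>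
     'v \<Rightarrow> side \<Rightarrow> nat \<Rightarrow> ereal \<Rightarrow> 'v ffs_state \<Rightarrow> (real \<times> 'v status) \<times> 'v ffs_state" where
  "resolve G x tie v = resolve_at G x tie (rem_depth G v) v"

text \<open>
  The root children allowed as a recommendation; the driver stops when there is one.  If
  \<open>scale G x 0 = 0\<close>, all root-child intervals are points and the driver stops immediately.
\<close>

definition recommendable ::
    "'v ffs_input \<Rightarrow> 'v samples \<Rightarrow> real \<Rightarrow> 'v ffs_state \<Rightarrow> 'v set" where
  "recommendable G x \<epsilon> st =
     {a \<in> tchildren G (troot G).
        lower G x st a \<ge> Max (upper G x st ` (tchildren G (troot G) - {a})) - \<epsilon>}"

text \<open>
  If no scale is available for either candidate, there is no call to make; the state is then kept, so
  that the run does not stop.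
\<close>

definition driver_step ::
    "'v ffs_input \<Rightarrow> 'v samples \<Rightarrow> ('v set \<Rightarrow> 'v) \<Rightarrow> 'v ffs_state \<Rightarrow> 'v ffs_state" where
  "driver_step G x tie st =
     (let C = tchildren G (troot G);
          a = tie (argmax_set (lower G x st) C);
          b = tie (argmax_set (upper G x st) (C - {a}));
          ka = next_scale G x st Lo a;
          bl = next_scale G x st Lo b;
          bu = next_scale G x st Up b;
          (sb, kb) =
            (if bl < \<infinity> \<and> (bu = \<infinity> \<or> scale G x (the_enat bl) \<ge> scale G x (the_enat bu))
             then (Lo, bl) else (Up, bu))
      in
      if ka < \<infinity> \<and> (kb = \<infinity> \<or> scale G x (the_enat ka) \<ge> scale G x (the_enat kb))
      then snd (resolve G x tie a Lo (the_enat ka) \<infinity> st)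
      else if kb < \<infinity> then snd (resolve G x tie b sb (the_enat kb) \<infinity> st)
      else st)"

text \<open>
  In round \<open>n\<close> of the driver, ties are broken by \<open>tie n\<close>.  Within one round no set of candidates
  occurs twice (the two sets of the driver differ, and the others consist of children of different
  nodes), so every way to break ties is of this form.
\<close>

primrec run ::
    "'v ffs_input \<Rightarrow> 'v samples \<Rightarrow> real \<Rightarrow> (nat \<Rightarrow> 'v set \<Rightarrow> 'v) \<Rightarrow> nat \<Rightarrow> 'v ffs_state" where
  "run G x \<epsilon> tie 0 = init_state G"
| "run G x \<epsilon> tie (Suc n) =
     (if recommendable G x \<epsilon> (run G x \<epsilon> tie n) \<noteq> {} then run G x \<epsilon> tie n
      else driver_step G x (tie n) (run G x \<epsilon> tie n))"

definition stop_time ::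
    "'v ffs_input \<Rightarrow> 'v samples \<Rightarrow> real \<Rightarrow> (nat \<Rightarrow> 'v set \<Rightarrow> 'v) \<Rightarrow> enat" where
  "stop_time G x \<epsilon> tie = Inf (enat ` {n. recommendable G x \<epsilon> (run G x \<epsilon> tie n) \<noteq> {}})"

definition returned ::
    "'v ffs_input \<Rightarrow> 'v samples \<Rightarrow> real \<Rightarrow> (nat \<Rightarrow> 'v set \<Rightarrow> 'v) \<Rightarrow> 'v" where
  "returned G x \<epsilon> tie =
     (let n = the_enat (stop_time G x \<epsilon> tie) in tie n (recommendable G x \<epsilon> (run G x \<epsilon> tie n)))"

text \<open>
  The recommendation of a procedure that need not stop; \<open>None\<close> means that there is none.  Ties may be
  broken by a non-measurable function of the outcome, so the probability is an outer measure, which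
  is the probability for all measurable sets.
\<close>

definition recommendation ::
    "'v ffs_input \<Rightarrow> 'v samples \<Rightarrow> real \<Rightarrow> (nat \<Rightarrow> 'v set \<Rightarrow> 'v) \<Rightarrow> 'v option" where
  "recommendation G x \<epsilon> tie =
     (if stop_time G x \<epsilon> tie < \<infinity> then Some (returned G x \<epsilon> tie) else None)"

definition PAC ::
    "'w measure \<Rightarrow> ('v, 'z) game_tree_scheme \<Rightarrow> 'v \<Rightarrow> real \<Rightarrow> real \<Rightarrow> ('w \<Rightarrow> 'v option) \<Rightarrow> bool" where
  "PAC M G a_star \<epsilon> \<delta> rec \<longleftrightarrow>
     outer_measure_of M {\<omega> \<in> space M. \<exists>a. rec \<omega> = Some a \<and> minimax G a_star - minimax G a > \<epsilon>}
       \<le> ennreal \<delta>"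

end

theory Submission
  imports Defs
begin

text \<open>
  Validity of the intervals does not depend on how a state was reached: by induction on the remaining
  depth, in every state whatsoever the effective interval of a non-root node contains its minimax value
  whenever the fast oracle respects its bias and all empirical means respect their radii.  A
  recommendable root child therefore loses at most \<open>\<epsilon>\<close> on the simultaneous-validity event, and
  the complement of this event is a finite union of events of probability at most \<open>alloc G v\<close>.
\<close>

section \<open>Depths and the minimax recursion in the tree\<close>

lemma node_depth_child:
  assumes tree: "rooted_tree G" and v: "v \<in> tnodes G" and u: "u \<in> tchildren G v"
  shows "node_depth G u = Suc (node_depth G v)"
proof -
  from tree v u have uG: "u \<in> tnodes G - {troot G}"
    unfolding rooted_tree_def by blast
  with tree v u have parent: "v' = v" if "v' \<in> tnodes G" "u \<in> tchildren G v'" for v'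
    using that unfolding rooted_tree_def by blast
  have edge: "(v', u) \<in> tedges G \<longleftrightarrow> v' = v" for v'
    using parent v u unfolding tedges_def by blast
  \<comment> \<open>As \<open>v\<close> is the only parent of \<open>u\<close>, every nonempty path
    from the root to \<open>u\<close> ends with the edge from \<open>v\<close>. The lengths of such
    paths are thus the successors of the path lengths to \<open>v\<close>. Since \<open>u\<close> is
    not the root, length 0 is excluded, and \<open>Least_Suc\<close> compares the two
    minima.\<close>
  have step: "(troot G, u) \<in> tedges G ^^ Suc m \<longleftrightarrow> (troot G, v) \<in> tedges G ^^ m" for m
    by (simp only: relpow.simps relcomp_unfold edge mem_Collect_eq prod.case) simp
  have "(troot G, v) \<in> (tedges G)\<^sup>*"
    using tree v unfolding rooted_tree_def by blast
  then obtain m where "(troot G, v) \<in> tedges G ^^ m"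
    by (auto simp: rtrancl_power)
  then have "(troot G, u) \<in> tedges G ^^ Suc m"
    by (simp only: step)
  moreover have "(troot G, u) \<notin> tedges G ^^ 0"
    using uG by auto
  ultimately have "(LEAST m. (troot G, u) \<in> tedges G ^^ m) = Suc (LEAST m. (troot G, u) \<in> tedges G ^^ Suc m)"
    by (rule Least_Suc)
  then show ?thesis
    by (simp only: node_depth_def step)
qed

lemma rem_depth_child:
  assumes "rooted_tree G" "v \<in> tnodes G" "u \<in> tchildren G v"
  shows "rem_depth G u = rem_depth G v - 1"
  \<comment> \<open>Truncated subtraction makes the equation hold at remaining depth 0 as
    well.\<close>
  by (simp add: rem_depth_def node_depth_child[OF assms])

lemma child_in_tnodes:
  assumes "rooted_tree G" "v \<in> tnodes G" "u \<in> tchildren G v"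
  shows "u \<in> tnodes G - {troot G}"
  using assms unfolding rooted_tree_def by blast

lemma finite_tchildren:
  assumes "rooted_tree G" "v \<in> tnodes G"
  shows "finite (tchildren G v)"
  using assms unfolding rooted_tree_def by (meson finite_subset)

lemma minimax_rec:
  assumes tree: "rooted_tree G" and v: "v \<in> tnodes G" and h: "rem_depth G v = Suc h"
  shows "minimax G v = (if is_max G v then Max (minimax G ` tchildren G v)
                        else Min (minimax G ` tchildren G v))"
proof -
  \<comment> \<open>The recursion hands the same counter \<open>h\<close> to all children; it is the
    remaining depth of each of them.\<close>
  have "minimax_at G h ` tchildren G v = minimax G ` tchildren G v"
    by (intro image_cong refl) (simp add: minimax_def rem_depth_child[OF tree v] h)
  then show ?thesis
    unfolding minimax_def[of G v] by (simp add: h)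
qed

section \<open>Validity of the intervals for one realisation of the samples\<close>

lemma Max_image_mono:
  fixes f g :: "'a \<Rightarrow> 'b::linorder"
  assumes "finite A" "A \<noteq> {}" "\<And>x. x \<in> A \<Longrightarrow> f x \<le> g x"
  shows "Max (f ` A) \<le> Max (g ` A)"
  using assms by (auto intro: order_trans[OF _ Max_ge])

lemma Min_image_mono:
  fixes f g :: "'a \<Rightarrow> 'b::linorder"
  assumes "finite A" "A \<noteq> {}" "\<And>x. x \<in> A \<Longrightarrow> f x \<le> g x"
  shows "Min (f ` A) \<le> Min (g ` A)"
  using assms by (auto intro: order_trans[OF Min_le])

text \<open>Maxima and minima are monotone, so bounds on all children pass to \<open>v\<close>; at
  an unexpanded node the interval is \<open>UNIV\<close>. The family \<open>I\<close> is arbitrary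
  because \<open>ivl_at\<close> supplies intervals computed at a fixed recursion level.\<close>

lemma minimax_mem_ch_ivl:
  assumes tree: "rooted_tree G" and v: "v \<in> tnodes G" and h: "rem_depth G v = Suc h"
    and inner: "tchildren G v \<noteq> {}"
    and I: "\<And>u. u \<in> tchildren G v \<Longrightarrow> minimax G u \<in> {Inf (I u)..Sup (I u)}"
  shows "minimax G v \<in> ch_ivl G st I v"
  using I finite_tchildren[OF tree v] inner
  \<comment> \<open>The deleted rules would split the inequalities between two maxima or minima
    before the monotonicity lemmas could match.\<close>
  by (simp add: ch_ivl_def minimax_rec[OF tree v h] Max_image_mono Min_image_mono
      del: Max_le_iff Max_ge_iff Min_le_iff Min_ge_iff)

text \<open>One fixed outcome of the simultaneous-validity event. Isolating it makes the whole
  interval argument deterministic.\<close>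

locale valid_samples =
  fixes G :: "'v ffs_input" and x :: "'v samples"
  assumes tree: "rooted_tree G"
    and leaves: "\<And>v. v \<in> tnodes G \<Longrightarrow> tchildren G v = {} \<longleftrightarrow> rem_depth G v = 0"
    and fast: "\<And>v. v \<in> tnodes G \<Longrightarrow> \<bar>fast_value G v - minimax G v\<bar> \<le> bias G (rem_depth G v)"
    and slow: "\<And>v n. v \<in> tnodes G - {troot G} \<Longrightarrow> 1 \<le> n \<Longrightarrow>
                 \<bar>emp_mean x v n - minimax G v\<bar> \<le> conf_radius G v n (alloc G v)"
begin

lemma minimax_mem_loc_ivl:
  assumes v: "v \<in> tnodes G - {troot G}"
  shows "minimax G v \<in> loc_ivl G x st v"
proof -
  have "minimax G v \<in> fast_ivl G v"
    using fast[of v] v by (auto simp: fast_ivl_def abs_le_iff)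
  moreover have "minimax G v \<in> slow_ivl G x st v"
    using slow[OF v] by (fastforce simp: slow_ivl_def abs_le_iff)
  ultimately show ?thesis
    by (simp add: loc_ivl_def)
qed

text \<open>This supplies boundedness: \<open>Inf\<close> and \<open>Sup\<close> of a set of reals
  act as endpoints only if the set is bounded. The root is excluded because it has no local
  interval.\<close>

lemma ivl_at_subset_fast_ivl:
  assumes "v \<noteq> troot G"
  shows "ivl_at G x st h v \<subseteq> fast_ivl G v"
  using assms by (cases h) (auto simp: loc_ivl_def)

lemma endpoints_ivl_at:
  assumes "v \<noteq> troot G" "y \<in> ivl_at G x st h v"
  shows "y \<in> {Inf (ivl_at G x st h v)..Sup (ivl_at G x st h v)}"
proof -
  have "bounded (ivl_at G x st h v)"
    using bounded_subset[OF _ ivl_at_subset_fast_ivl[OF assms(1)]]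
    by (simp add: fast_ivl_def)
  then show ?thesis
    using assms(2)
    by (auto intro: cInf_lower cSup_upper bounded_imp_bdd_below bounded_imp_bdd_above)
qed

lemma minimax_mem_ivl_at:
  assumes "v \<in> tnodes G - {troot G}" "rem_depth G v = h"
  shows "minimax G v \<in> ivl_at G x st h v"
  using assms
proof (induction h arbitrary: v)
  case 0
  then show ?case
    by (simp add: minimax_mem_loc_ivl)
next
  case (Suc h)
  have v: "v \<in> tnodes G"
    using Suc.prems by blast
  \<comment> \<open>\<open>ch_ivl\<close> sees only the endpoints of the child intervals, so
    membership from the induction hypothesis is weakened to lying between them.\<close>
  have "minimax G u \<in> {Inf (ivl_at G x st h u)..Sup (ivl_at G x st h u)}"
    if "u \<in> tchildren G v" for u
    using endpoints_ivl_at Suc.IH[of u] child_in_tnodes[OF tree v that]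
      rem_depth_child[OF tree v that] Suc.prems
    by simp
  then have "minimax G v \<in> ch_ivl G st (ivl_at G x st h) v"
    \<comment> \<open>Positive remaining depth makes \<open>v\<close> internal, so
      \<open>Max\<close> and \<open>Min\<close> range over a nonempty set.\<close>
    using Suc.prems leaves[OF v] by (intro minimax_mem_ch_ivl[OF tree v]) auto
  then show ?case
    using Suc.prems minimax_mem_loc_ivl by simp
qed

lemma minimax_between:
  assumes "v \<in> tnodes G - {troot G}"
  shows "lower G x st v \<le> minimax G v" "minimax G v \<le> upper G x st v"
  using endpoints_ivl_at[OF _ minimax_mem_ivl_at[OF assms refl]] assms
  by (auto simp: lower_def upper_def ivl_def)

text \<open>The stopping rule separates the lower endpoint of \<open>a\<close> from the upper
  endpoints of its rivals, and validity turns this into a comparison of values. The maximum omits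
  \<open>a\<close> itself, so \<open>b = a\<close> is treated apart, using that \<epsilon> is
  nonnegative.\<close>

lemma recommendable_optimal:
  assumes a: "a \<in> recommendable G x \<epsilon> st" and b: "b \<in> tchildren G (troot G)" and "\<epsilon> \<ge> 0"
  shows "minimax G b - minimax G a \<le> \<epsilon>"
proof (cases "b = a")
  case True
  then show ?thesis
    using \<open>\<epsilon> \<ge> 0\<close> by simp
next
  case False
  have r: "troot G \<in> tnodes G"
    using tree by (simp add: rooted_tree_def)
  have aC: "a \<in> tchildren G (troot G)"
    using a by (simp add: recommendable_def)
  have "minimax G b \<le> upper G x st b"
    using child_in_tnodes[OF tree r b] by (rule minimax_between)
  also have "\<dots> \<le> Max (upper G x st ` (tchildren G (troot G) - {a}))"
    using False b finite_tchildren[OF tree r] by simp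
  also have "\<dots> \<le> lower G x st a + \<epsilon>"
    using a by (simp add: recommendable_def)
  also have "\<dots> \<le> minimax G a + \<epsilon>"
    using minimax_between(1)[OF child_in_tnodes[OF tree r aC]] by simp
  finally show ?thesis
    by simp
qed

end

section \<open>The stopping time and the union bound\<close>

lemma returned_recommendable:
  assumes "stop_time G x \<epsilon> tie < \<infinity>" and "\<And>n S. S \<noteq> {} \<Longrightarrow> tie n S \<in> S"
  shows "\<exists>n. returned G x \<epsilon> tie \<in> recommendable G x \<epsilon> (run G x \<epsilon> tie n)"
proof -
  let ?N = "{n. recommendable G x \<epsilon> (run G x \<epsilon> tie n) \<noteq> {}}"
  \<comment> \<open>The empty infimum is \<infinity>, so a finite stopping time means that some
    round stops; the infimum is then a \<open>LEAST\<close> element, hence attained.\<close>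
  have "enat ` ?N \<noteq> {}"
    using assms(1) by (auto simp: stop_time_def Inf_enat_def split: if_splits)
  then have "Inf (enat ` ?N) \<in> enat ` ?N"
    unfolding Inf_enat_def by (simp only: if_False) (metis LeastI ex_in_conv)
  then obtain n where "stop_time G x \<epsilon> tie = enat n" "n \<in> ?N"
    by (auto simp: stop_time_def)
  then show ?thesis
    using assms(2) by (auto simp: returned_def)
qed

lemma sets_radius_violation:
  assumes "\<And>i. X v i \<in> borel_measurable M"
  shows "{\<omega> \<in> space M. \<exists>n\<ge>1. \<bar>emp_mean (\<lambda>v i. X v i \<omega>) v n - m\<bar> > r n} \<in> sets M"
proof -
  note assms [measurable]
  show ?thesis
    unfolding emp_mean_def by measurable
qed

text \<open>The set \<open>A\<close> may be non-measurable, as ties may be broken by any function of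
  the outcome. It is enlarged to a measurable union before subadditivity is applied.\<close>

lemma (in finite_measure) outer_measure_of_le_sum:
  assumes "finite S" "\<And>v. v \<in> S \<Longrightarrow> B v \<in> sets M" "\<And>v. v \<in> S \<Longrightarrow> measure M (B v) \<le> d v"
    and "A \<subseteq> (\<Union>v\<in>S. B v)"
  shows "outer_measure_of M A \<le> ennreal (\<Sum>v\<in>S. d v)"
proof -
  have "(\<Union>v\<in>S. B v) \<in> sets M"
    using assms by blast
  then have "outer_measure_of M A \<le> emeasure M (\<Union>v\<in>S. B v)"
    using outer_measure_of_mono[OF assms(4), of M] by simp
  also have "\<dots> = ennreal (measure M (\<Union>v\<in>S. B v))"
    by (rule emeasure_eq_measure)
  also have "\<dots> \<le> ennreal (\<Sum>v\<in>S. d v)"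
    using assms(1-3)
    by (intro ennreal_leI order_trans[OF finite_measure_subadditive_finite] sum_mono) auto
  finally show ?thesis .
qed

lemma measure_le_outer_measure_of:
  assumes "outer_measure_of M A \<le> ennreal d" "0 \<le> d"
  shows "measure M A \<le> d"
proof (cases "A \<in> sets M")
  case True
  then show ?thesis
    using assms by (simp add: measure_def enn2real_leI)
next
  \<comment> \<open>By convention \<open>measure\<close> is 0 on non-measurable sets.\<close>
  case False
  then show ?thesis
    using assms by (simp add: measure_notin_sets)
qed

theorem theorem3p1:
  fixes G :: "'v ffs_input"
    and M :: "'w measure"
    and X :: "'v \<Rightarrow> nat \<Rightarrow> 'w \<Rightarrow> real"
    and tie :: "'w \<Rightarrow> nat \<Rightarrow> 'v set \<Rightarrow> 'v"
    and a_star :: 'v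
    and \<sigma> \<delta> \<epsilon> :: real
  assumes tree: "rooted_tree G"
    and depth: "tree_depth G \<ge> 1"
    and leaves: "\<forall>v\<in>tnodes G. tchildren G v = {} \<longleftrightarrow> rem_depth G v = 0"
    and root_children: "card (tchildren G (troot G)) \<ge> 2"
    and a_star: "argmax_set (minimax G) (tchildren G (troot G)) = {a_star}"
    and bias_0: "bias G 0 = 0"
    and bias_nonneg: "\<forall>h\<le>tree_depth G. bias G h \<ge> 0"
    and bias_mono: "\<forall>h<tree_depth G. bias G h \<le> bias G (h + 1)"
    and fast: "\<forall>v\<in>tnodes G. \<bar>fast_value G v - minimax G v\<bar> \<le> bias G (rem_depth G v)"
    and cost: "slow_cost G \<ge> 1"
    and prob_space: "prob_space M"
    and sigma: "\<sigma> \<ge> 0"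
    and slow_indep: "\<forall>v\<in>tnodes G. prob_space.indep_vars M (\<lambda>_. borel) (X v) UNIV"
    and slow_subgauss: "\<forall>v\<in>tnodes G. \<forall>i. sub_gaussian M \<sigma> (minimax G v) (X v i)"
    and conf_mono: "\<forall>v\<in>tnodes G - {troot G}. \<forall>m n. 1 \<le> m \<and> m \<le> n \<longrightarrow>
                      conf_radius G v n (alloc G v) \<le> conf_radius G v m (alloc G v)"
    and conf_lim: "\<forall>v\<in>tnodes G - {troot G}. (\<lambda>n. conf_radius G v n (alloc G v)) \<longlonglongrightarrow> 0"
    and conf_valid: "\<forall>v\<in>tnodes G - {troot G}.
                       measure M {\<omega> \<in> space M. \<exists>n\<ge>1.
                         \<bar>emp_mean (\<lambda>v i. X v i \<omega>) v n - minimax G v\<bar> > conf_radius G v n (alloc G v)}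
                       \<le> alloc G v"
    and budget_ge1: "\<forall>h\<le>tree_depth G. budget G h \<ge> 1"
    and budget_mono: "\<forall>h<tree_depth G. budget G h \<le> budget G (h + 1)"
    and delta: "0 < \<delta>" "\<delta> < 1"
    and alloc: "\<forall>v\<in>tnodes G - {troot G}. 0 < alloc G v \<and> alloc G v < 1"
    and alloc_sum: "(\<Sum>v\<in>tnodes G - {troot G}. alloc G v) \<le> \<delta>"
    and epsilon: "\<epsilon> \<ge> 0"
    and tie: "\<forall>\<omega> n S. S \<noteq> {} \<longrightarrow> tie \<omega> n S \<in> S"
  shows
    "let \<tau> = (\<lambda>\<omega>. stop_time G (\<lambda>v i. X v i \<omega>) \<epsilon> (tie \<omega>));
         a_hat = (\<lambda>\<omega>. returned G (\<lambda>v i. X v i \<omega>) \<epsilon> (tie \<omega>));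
         bad = {\<omega> \<in> space M. \<tau> \<omega> < \<infinity> \<and> minimax G a_star - minimax G (a_hat \<omega>) > \<epsilon>}
     in outer_measure_of M bad \<le> ennreal \<delta> \<and> measure M bad \<le> \<delta> \<and>
        (\<forall>\<omega>\<in>simultaneous_validity M G X.
           \<tau> \<omega> < \<infinity> \<longrightarrow> a_hat \<omega> \<in> tchildren G (troot G) \<and>
             minimax G a_star - minimax G (a_hat \<omega>) \<le> \<epsilon>) \<and>
        PAC M G a_star \<epsilon> \<delta> (\<lambda>\<omega>. recommendation G (\<lambda>v i. X v i \<omega>) \<epsilon> (tie \<omega>))"
proof -
  define \<tau> where "\<tau> = (\<lambda>\<omega>. stop_time G (\<lambda>v i. X v i \<omega>) \<epsilon> (tie \<omega>))"
  define a_hat where "a_hat = (\<lambda>\<omega>. returned G (\<lambda>v i. X v i \<omega>) \<epsilon> (tie \<omega>))"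
  define bad where
    "bad = {\<omega> \<in> space M. \<tau> \<omega> < \<infinity> \<and> minimax G a_star - minimax G (a_hat \<omega>) > \<epsilon>}"
  let ?S = "tnodes G - {troot G}"
  let ?B = "\<lambda>v. {\<omega> \<in> space M. \<exists>n\<ge>1.
    \<bar>emp_mean (\<lambda>v i. X v i \<omega>) v n - minimax G v\<bar> > conf_radius G v n (alloc G v)}"
  interpret prob_space M
    by (rule prob_space)
  have a_star_child: "a_star \<in> tchildren G (troot G)"
    using a_star by (auto simp: argmax_set_def)
  have sound: "a_hat \<omega> \<in> tchildren G (troot G) \<and> minimax G a_star - minimax G (a_hat \<omega>) \<le> \<epsilon>"
    if \<omega>: "\<omega> \<in> simultaneous_validity M G X" and stop: "\<tau> \<omega> < \<infinity>" for \<omega>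
  proof -
    interpret valid_samples G "\<lambda>v i. X v i \<omega>"
      using tree leaves fast \<omega> by unfold_locales (auto simp: simultaneous_validity_def)
    obtain n where "a_hat \<omega> \<in> recommendable G (\<lambda>v i. X v i \<omega>) \<epsilon>
                      (run G (\<lambda>v i. X v i \<omega>) \<epsilon> (tie \<omega>) n)"
      using returned_recommendable[of G "\<lambda>v i. X v i \<omega>" \<epsilon> "tie \<omega>"] stop tie
      unfolding \<tau>_def a_hat_def by blast
    then show ?thesis
      using recommendable_optimal[OF _ a_star_child epsilon] by (auto simp: recommendable_def)
  qed
  have cover: "bad \<subseteq> (\<Union>v\<in>?S. ?B v)"
  proof
    fix \<omega> assume "\<omega> \<in> bad"
    with sound[of \<omega>] have "\<omega> \<in> space M - simultaneous_validity M G X"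
      by (auto simp: bad_def)
    then show "\<omega> \<in> (\<Union>v\<in>?S. ?B v)"
      by (auto simp: simultaneous_validity_def not_le)
  qed
  have fin: "finite ?S"
    using tree by (simp add: rooted_tree_def)
  \<comment> \<open>Measurability of the samples comes from the integrability contained in
    \<open>sub_gaussian\<close>.\<close>
  have meas: "?B v \<in> sets M" if "v \<in> ?S" for v
    using slow_subgauss that
    by (intro sets_radius_violation) (auto simp: sub_gaussian_def)
  have "outer_measure_of M bad \<le> ennreal (\<Sum>v\<in>?S. alloc G v)"
    using fin meas conf_valid[rule_format] cover by (rule outer_measure_of_le_sum)
  also have "\<dots> \<le> ennreal \<delta>"
    using alloc_sum by (rule ennreal_leI)
  finally have outer: "outer_measure_of M bad \<le> ennreal \<delta>" .
  then have "measure M bad \<le> \<delta>"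
    using delta by (intro measure_le_outer_measure_of) auto
  moreover have "PAC M G a_star \<epsilon> \<delta> (\<lambda>\<omega>. recommendation G (\<lambda>v i. X v i \<omega>) \<epsilon> (tie \<omega>))"
  proof -
    \<comment> \<open>A recommendation exists exactly when the stopping time is finite, so both
      formulations describe the same failure set.\<close>
    have "{\<omega> \<in> space M. \<exists>a. recommendation G (\<lambda>v i. X v i \<omega>) \<epsilon> (tie \<omega>) = Some a \<and>
             minimax G a_star - minimax G a > \<epsilon>} = bad"
      by (auto simp: recommendation_def bad_def \<tau>_def a_hat_def split: if_splits)
    then show ?thesis
      using outer by (simp add: PAC_def)
  qed
  ultimately show ?thesis
    using outer sound unfolding Let_def bad_def \<tau>_def a_hat_def by blast
qed

end
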